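(* Let $H$ be a connected graph with at least three nodes and let $r_H = \widetilde{\operatorname{diam}}(H) - 1$. For every integer $T < r_H$, there exists no $T$-round algorithm for $\textsc{MemList}(H)$ or for $\textsc{MemDetect}(H)$ under edge insertions, and none under edge deletions.
   Context: For nodes $u,v$ of a graph $G$, $\operatorname{dist}_G(u,v)$ is the shortest-path distance. The node-edge distance between a node $u$ and an edge $e=\{v,w\}$ is $\operatorname{dist}_G(u,e) = 1 + \min\{\operatorname{dist}_G(u,v), \operatorname{dist}_G(u,w)\}$, and the node-edge diameter is $\widetilde{\operatorname{diam}}(G) = \max_{u \in V(G)} \max_{e \in E(G)} \operatorname{dist}_G(u,e)$. Dynamic network model: a sequence of graphs $G^0, G^1, \ldots$, each obtained from the previous by at most one topological change of the allowed type; nodes have distinct IDs, know their neighbors' IDs and initially the whole of $G^0$; communication is synchronous, each round the change happens first and then each node sends a message to each neighbor (here bandwidth is arbitrary); nodes detect changes only through their neighbor lists. A $T$-round algorithm works under the promise that each change at round $i$ is followed by $T-1$ change-free rounds and must output correctly for $G^i$ by the end of round $i+T-1$. $\textsc{MemList}(H)$: each node $v$ lists all subgraphs isomorphic to $H$ containing $v$. $\textsc{MemDetect}(H)$: each node $v$ outputs whether it belongs to some subgraph isomorphic to $H$. *)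

theory Defs
  imports Main
begin

section \<open>Finite simple graphs\<close>

datatype 'a graph = Graph (verts: "'a set") (edges: "'a set set")

definition simple_graph :: "'a graph \<Rightarrow> bool" where
  "simple_graph G \<longleftrightarrow> finite (verts G) \<and> (\<forall>e \<in> edges G. e \<subseteq> verts G \<and> card e = 2)"

definition nbrs :: "'a graph \<Rightarrow> 'a \<Rightarrow> 'a set" where
  "nbrs G v = {u. {v, u} \<in> edges G}"

definition adj_rel :: "'a graph \<Rightarrow> 'a rel" where
  "adj_rel G = {(u, v). {u, v} \<in> edges G}"

definition connected_graph :: "'a graph \<Rightarrow> bool" where
  "connected_graph G \<longleftrightarrow>
     verts G \<noteq> {} \<and> (\<forall>u \<in> verts G. \<forall>v \<in> verts G. (u, v) \<in> (adj_rel G)\<^sup>*)"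

definition subgraph_of :: "'a graph \<Rightarrow> 'a graph \<Rightarrow> bool" where
  "subgraph_of K G \<longleftrightarrow> simple_graph K \<and> verts K \<subseteq> verts G \<and> edges K \<subseteq> edges G"

definition graph_iso :: "'a graph \<Rightarrow> 'b graph \<Rightarrow> bool" where
  "graph_iso G H \<longleftrightarrow>
     (\<exists>f. bij_betw f (verts G) (verts H) \<and>
          (\<forall>u \<in> verts G. \<forall>v \<in> verts G. {u, v} \<in> edges G \<longleftrightarrow> {f u, f v} \<in> edges H))"

text \<open>
  A pair is in \<open>adj_rel G ^^ k\<close> iff it is joined by a walk with \<open>k\<close> edges. The value is
  unspecified for nodes in different components; the distance notions below are only applied
  to a connected graph.
\<close>

definition graph_dist :: "'a graph \<Rightarrow> 'a \<Rightarrow> 'a \<Rightarrow> nat" where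
  "graph_dist G u v = (LEAST k. (u, v) \<in> adj_rel G ^^ k)"

definition node_edge_dist :: "'a graph \<Rightarrow> 'a \<Rightarrow> 'a set \<Rightarrow> nat" where
  "node_edge_dist G u e = 1 + (MIN v \<in> e. graph_dist G u v)"

definition node_edge_diam :: "'a graph \<Rightarrow> nat" where
  "node_edge_diam G = (MAX u \<in> verts G. MAX e \<in> edges G. node_edge_dist G u e)"


section \<open>Dynamic networks\<close>

text \<open>
  The nodes of a network are identified with their IDs, which are natural numbers. The graph
  \<open>Gs i\<close> is the network after the change of round \<open>i\<close>; rounds are numbered from 1, and
  \<open>Gs 0\<close> is the initial graph. The node set never changes.
\<close>

definition edge_insertion :: "nat graph \<Rightarrow> nat graph \<Rightarrow> bool" where
  "edge_insertion G G' \<longleftrightarrow>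
     (\<exists>u \<in> verts G. \<exists>v \<in> verts G. u \<noteq> v \<and> {u, v} \<notin> edges G \<and>
        G' = Graph (verts G) (insert {u, v} (edges G)))"

definition edge_deletion :: "nat graph \<Rightarrow> nat graph \<Rightarrow> bool" where
  "edge_deletion G G' \<longleftrightarrow> (\<exists>e \<in> edges G. G' = Graph (verts G) (edges G - {e}))"

definition change_at :: "(nat \<Rightarrow> nat graph) \<Rightarrow> nat \<Rightarrow> bool" where
  "change_at Gs i \<longleftrightarrow> 0 < i \<and> Gs i \<noteq> Gs (i - 1)"

text \<open>
  The last conjunct is the promise that a change at round \<open>i\<close> is followed by the \<open>T - 1\<close>
  change-free rounds \<open>i + 1, \<dots>, i + T - 1\<close>; it is void for \<open>T \<le> 1\<close>.
\<close>

definition dynamic_network ::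
  "(nat graph \<Rightarrow> nat graph \<Rightarrow> bool) \<Rightarrow> int \<Rightarrow> (nat \<Rightarrow> nat graph) \<Rightarrow> bool" where
  "dynamic_network chg T Gs \<longleftrightarrow>
     simple_graph (Gs 0) \<and>
     (\<forall>i. Gs (Suc i) = Gs i \<or> chg (Gs i) (Gs (Suc i))) \<and>
     (\<forall>i j. change_at Gs i \<and> i < j \<and> int j \<le> int i + T - 1 \<longrightarrow> \<not> change_at Gs j)"


section \<open>Deterministic distributed algorithms\<close>

text \<open>
  States \<open>'s\<close> and messages \<open>'m\<close> range over arbitrary types, so neither memory nor bandwidth is
  bounded. In round \<open>i\<close> a node sees only its state, its neighbour list in \<open>Gs i\<close> and the
  messages received; its ID, its earlier neighbour lists and the round number can be kept in
  the state.
    \<^item> \<open>alg_init G0 v\<close>: initial state of node \<open>v\<close>, which knows the whole initial graph;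
    \<^item> \<open>alg_send s N u\<close>: message to the neighbour \<open>u\<close> in state \<open>s\<close> with neighbour list \<open>N\<close>;
    \<^item> \<open>alg_recv s N M\<close>: next state, where \<open>M u\<close> is the message received from \<open>u\<close>, if any.
\<close>

record ('s, 'm, 'o) algorithm =
  alg_init :: "nat graph \<Rightarrow> nat \<Rightarrow> 's"
  alg_send :: "'s \<Rightarrow> nat set \<Rightarrow> nat \<Rightarrow> 'm"
  alg_recv :: "'s \<Rightarrow> nat set \<Rightarrow> (nat \<rightharpoonup> 'm) \<Rightarrow> 's"
  alg_output :: "'s \<Rightarrow> 'o"

text \<open>\<open>run A Gs t v\<close> is the state of node \<open>v\<close> at the end of round \<open>t\<close>.\<close>

fun run :: "('s, 'm, 'o) algorithm \<Rightarrow> (nat \<Rightarrow> nat graph) \<Rightarrow> nat \<Rightarrow> nat \<Rightarrow> 's" where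
  "run A Gs 0 v = alg_init A (Gs 0) v"
| "run A Gs (Suc t) v =
     (let G = Gs (Suc t) in
      alg_recv A (run A Gs t v) (nbrs G v)
        (\<lambda>u. if u \<in> nbrs G v then Some (alg_send A (run A Gs t u) (nbrs G u) v) else None))"

text \<open>
  A problem \<open>P\<close> gives the correct output \<open>P G v\<close> of node \<open>v\<close> in the network \<open>G\<close>. The
  algorithm is only held to the outputs due after a change, at the end of round
  \<open>i + T - 1\<close>; any stronger requirement would admit
  fewer algorithms and so make non-existence a weaker claim.
\<close>

definition is_round_algorithm ::
  "(nat graph \<Rightarrow> nat graph \<Rightarrow> bool) \<Rightarrow> int \<Rightarrow> (nat graph \<Rightarrow> nat \<Rightarrow> 'o)
     \<Rightarrow> ('s, 'm, 'o) algorithm \<Rightarrow> bool" where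
  "is_round_algorithm chg T P A \<longleftrightarrow>
     (\<forall>Gs. dynamic_network chg T Gs \<longrightarrow>
       (\<forall>i t. change_at Gs i \<and> int t = int i + T - 1 \<longrightarrow>
         (\<forall>v \<in> verts (Gs i). alg_output A (run A Gs t v) = P (Gs i) v)))"


section \<open>Subgraph finding problems\<close>

definition mem_list :: "'h graph \<Rightarrow> nat graph \<Rightarrow> nat \<Rightarrow> nat graph set" where
  "mem_list H G v = {K. subgraph_of K G \<and> graph_iso K H \<and> v \<in> verts K}"

definition mem_detect :: "'h graph \<Rightarrow> nat graph \<Rightarrow> nat \<Rightarrow> bool" where
  "mem_detect H G v \<longleftrightarrow> (\<exists>K. subgraph_of K G \<and> graph_iso K H \<and> v \<in> verts K)"

end

theory Submission
  imports Defs
begin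

text \<open>
  Choose a node \<open>u\<close> and an edge \<open>e\<close> of \<open>H\<close> realising the node-edge diameter, and place a
  copy of \<open>H\<close> next to two further nodes \<open>a\<close>, \<open>b\<close>. Starting from \<open>H - e\<close>, compare the insertion
  of \<open>e\<close> with the insertion of \<open>ab\<close>; starting from \<open>H + ab\<close>, compare the deletion of \<open>ab\<close> with the
  deletion of \<open>e\<close>. Both comparisons end in the same two graphs \<open>H\<close> and \<open>H - e + ab\<close>: \<open>u\<close> lies in
  a copy of \<open>H\<close> in the first, but not in the second, whose component of \<open>u\<close> has too few edges.
  News of the change starts at the ends of the changed edge and travels one edge per
  round, so \<open>u\<close> cannot distinguish the two executions within fewer than \<open>r\<^sub>H\<close> rounds.
\<close>

section \<open>Graph isomorphisms, distances and the node-edge diameter\<close>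

lemma adj_rel_iff: "(u, v) \<in> adj_rel G \<longleftrightarrow> {u, v} \<in> edges G"
  by (simp add: adj_rel_def)

lemma simple_graph_finite_edges: "simple_graph G \<Longrightarrow> finite (edges G)"
  by (rule finite_subset[of _ "Pow (verts G)"]) (auto simp: simple_graph_def)

lemma simple_graph_edge_verts:
  assumes "simple_graph G" "{u, v} \<in> edges G"
  shows "u \<in> verts G" "v \<in> verts G"
  using assms by (auto simp: simple_graph_def)

lemma simple_graph_edgeE:
  assumes "simple_graph G" "e \<in> edges G"
  obtains u v where "e = {u, v}" "u \<noteq> v" "u \<in> verts G" "v \<in> verts G"
proof -
  have "card e = 2" "e \<subseteq> verts G"
    using assms by (auto simp: simple_graph_def)
  then show ?thesis
    using that by (auto simp: card_2_iff)
qed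

lemma graph_iso_edges:
  assumes K: "simple_graph K" and H: "simple_graph H"
    and f: "bij_betw f (verts K) (verts H)"
    and ed: "\<forall>u \<in> verts K. \<forall>v \<in> verts K. {u, v} \<in> edges K \<longleftrightarrow> {f u, f v} \<in> edges H"
  shows "edges H = (`) f ` edges K"
proof (intro equalityI subsetI)
  fix e assume e: "e \<in> edges H"
  then obtain x y where xy: "e = {x, y}" "x \<in> verts H" "y \<in> verts H"
    using H by (elim simple_graph_edgeE) auto
  then obtain u v where uv: "u \<in> verts K" "v \<in> verts K" "x = f u" "y = f v"
    using f by (metis bij_betw_imp_surj_on imageE)
  then have "{u, v} \<in> edges K" "e = f ` {u, v}"
    using ed e xy by auto
  then show "e \<in> (`) f ` edges K"
    by blast
next
  fix e assume "e \<in> (`) f ` edges K"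
  then obtain e' where e': "e' \<in> edges K" "e = f ` e'"
    by auto
  then obtain u v where "e' = {u, v}" "u \<in> verts K" "v \<in> verts K"
    using K by (elim simple_graph_edgeE) auto
  then show "e \<in> edges H"
    using ed e' by auto
qed

lemma graph_iso_card_edges:
  assumes "simple_graph K" "simple_graph H" "graph_iso K H"
  shows "card (edges H) \<le> card (edges K)"
  using assms
  by (metis card_image_le graph_iso_def graph_iso_edges simple_graph_finite_edges)

text \<open>A walk in \<open>H\<close> lifts step by step through \<open>f\<close>: surjectivity
  supplies the next node, the edge equivalence supplies the next edge, and injectivity identifies
  the end.\<close>

lemma graph_iso_connected:
  assumes H: "simple_graph H" "connected_graph H" and iso: "graph_iso K H"
  shows "connected_graph K"
proof -
  from iso obtain f where f: "bij_betw f (verts K) (verts H)"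
    and ed: "\<forall>u \<in> verts K. \<forall>v \<in> verts K. {u, v} \<in> edges K \<longleftrightarrow> {f u, f v} \<in> edges H"
    by (auto simp: graph_iso_def)
  have lift: "\<exists>x \<in> verts K. f x = y \<and> (u, x) \<in> (adj_rel K)\<^sup>*"
    if "(f u, y) \<in> (adj_rel H)\<^sup>*" "u \<in> verts K" for u y
    using that(1)
  proof (induction rule: rtrancl_induct)
    case base
    then show ?case using that by blast
  next
    case (step y z)
    then obtain x where x: "x \<in> verts K" "f x = y" "(u, x) \<in> (adj_rel K)\<^sup>*"
      by blast
    have yz: "{y, z} \<in> edges H"
      using step by (simp add: adj_rel_iff)
    then have "z \<in> verts H"
      using H simple_graph_edge_verts by metis
    then obtain w where "w \<in> verts K" "f w = z"
      using f by (metis bij_betw_imp_surj_on imageE)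
    moreover from this have "(x, w) \<in> adj_rel K"
      using ed x yz by (auto simp: adj_rel_iff)
    ultimately show ?case
      using x(3) by (blast intro: rtrancl.rtrancl_into_rtrancl)
  qed
  have "(u, v) \<in> (adj_rel K)\<^sup>*" if "u \<in> verts K" "v \<in> verts K" for u v
  proof -
    have "(f u, f v) \<in> (adj_rel H)\<^sup>*"
      using H(2) f that by (auto simp: connected_graph_def bij_betw_def)
    from lift[OF this that(1)] show ?thesis
      using f that by (auto simp: bij_betw_def dest: inj_onD)
  qed
  moreover have "verts K \<noteq> {}"
    using H(2) f by (auto simp: connected_graph_def bij_betw_def)
  ultimately show ?thesis
    by (simp add: connected_graph_def)
qed

lemma graph_dist_self: "graph_dist G v v = 0"
  unfolding graph_dist_def by (rule Least_eq_0) simp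

text \<open>Prepend the edge to a shortest walk from \<open>w\<close>; connectedness provides some
  walk, so the \<open>LEAST\<close> is attained.\<close>

lemma graph_dist_step:
  assumes "connected_graph G" "{u, w} \<in> edges G" "w \<in> verts G" "v \<in> verts G"
  shows "graph_dist G u v \<le> Suc (graph_dist G w v)"
proof -
  have "(w, v) \<in> (adj_rel G)\<^sup>*"
    using assms by (simp add: connected_graph_def)
  then have "\<exists>k. (w, v) \<in> adj_rel G ^^ k"
    using rtrancl_imp_relpow by blast
  then have "(w, v) \<in> adj_rel G ^^ graph_dist G w v"
    unfolding graph_dist_def by (rule LeastI_ex)
  then have "(u, v) \<in> adj_rel G ^^ Suc (graph_dist G w v)"
    using assms(2) by (intro relpow_Suc_I2) (simp_all add: adj_rel_iff)
  then show ?thesis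
    unfolding graph_dist_def by (rule Least_le)
qed

text \<open>Without edges a node reaches only itself. This makes the maximum over edges in
  \<open>node_edge_diam\<close> range over a nonempty set.\<close>

lemma connected_graph_edge_exists:
  assumes "connected_graph G" "card (verts G) \<ge> 2"
  shows "edges G \<noteq> {}"
proof
  assume "edges G = {}"
  then have "adj_rel G = {}"
    by (auto simp: adj_rel_def)
  then have "\<forall>u \<in> verts G. \<forall>v \<in> verts G. u = v"
    using assms(1) by (auto simp: connected_graph_def)
  \<comment> \<open>Infinite sets have cardinality 0.\<close>
  moreover have "finite (verts G)"
    using assms(2) by (intro card_ge_0_finite) simp
  ultimately have "card (verts G) \<le> Suc 0"
    by (simp add: card_le_Suc0_iff_eq)
  with assms(2) show False by simp
qed

lemma node_edge_diam_attained:
  assumes "simple_graph G" "verts G \<noteq> {}" "edges G \<noteq> {}"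
  obtains u e where "u \<in> verts G" "e \<in> edges G" "node_edge_diam G = node_edge_dist G u e"
proof -
  let ?d = "node_edge_dist G"
  have fin: "finite (verts G)" "finite (edges G)"
    using assms(1) simple_graph_finite_edges by (auto simp: simple_graph_def)
  have "node_edge_diam G \<in> (\<lambda>u. MAX e \<in> edges G. ?d u e) ` verts G"
    unfolding node_edge_diam_def using fin assms by (intro Max_in) auto
  then obtain u where u: "u \<in> verts G" "node_edge_diam G = (MAX e \<in> edges G. ?d u e)"
    by auto
  have "(MAX e \<in> edges G. ?d u e) \<in> ?d u ` edges G"
    using fin assms by (intro Max_in) auto
  then show ?thesis
    using u that by auto
qed

section \<open>Indistinguishable executions\<close>

text \<open>
  Here \<open>d x\<close> is the distance from \<open>x\<close> to the nodes at which two executions that agree up to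
  round \<open>k\<close> may have different neighbour lists.
\<close>

lemma run_indistinguishable:
  assumes before: "\<And>j. j \<le> k \<Longrightarrow> Gs j = Gs' j"
    and nb: "\<And>j x. \<lbrakk>j > k; d x > 0\<rbrakk> \<Longrightarrow> nbrs (Gs j) x = nbrs (Gs' j) x"
    and lip: "\<And>j x y. \<lbrakk>j > k; d x > 0; y \<in> nbrs (Gs j) x\<rbrakk> \<Longrightarrow> d x \<le> Suc (d y)"
    and "t \<le> k \<or> t < d x + k"
  shows "run A Gs t x = run A Gs' t x"
  using assms(4)
proof (induction t arbitrary: x)
  case 0
  then show ?case by (simp add: before)
next
  case (Suc t)
  show ?case
  proof (cases "Suc t \<le> k")
    case True
    then have "run A Gs t y = run A Gs' t y" for y
      using Suc.IH by simp
    then show ?thesis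
      using before[OF True] by (simp add: Let_def cong: if_cong)
  next
    case False
    then have dx: "Suc t < d x + k" "k < Suc t"
      using Suc.prems by auto
    have nx: "nbrs (Gs (Suc t)) x = nbrs (Gs' (Suc t)) x"
      using dx by (intro nb) auto
    have sx: "run A Gs t x = run A Gs' t x"
      using dx by (intro Suc.IH) auto
    have "run A Gs t y = run A Gs' t y \<and> nbrs (Gs (Suc t)) y = nbrs (Gs' (Suc t)) y"
      if "y \<in> nbrs (Gs (Suc t)) x" for y
    proof -
      \<comment> \<open>The message of \<open>y\<close> depends on its state after round
        \<open>t\<close> and on its list in round \<open>Suc t\<close>. The bound gives
        \<open>t < d y + k\<close> for the former and, as \<open>k < Suc t\<close>, also
        \<open>d y > 0\<close> for the latter.\<close>
      have "d x \<le> Suc (d y)"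
        using lip[OF dx(2) _ that] dx by auto
      then show ?thesis
        using dx by (intro conjI Suc.IH nb) auto
    qed
    then show ?thesis
      using nx sx by (auto simp: Let_def intro!: arg_cong[where f = "alg_recv A _ _"])
  qed
qed

lemma change_at_single:
  assumes "G \<noteq> G'"
  shows "change_at (\<lambda>j. if j \<le> k then G else G') i \<longleftrightarrow> i = Suc k"
  using assms by (auto simp: change_at_def)

text \<open>With a single change no later one can break the promise, whatever the value of
  \<open>T\<close>.\<close>

lemma dynamic_network_single:
  assumes "simple_graph G" "chg G G'" "G \<noteq> G'"
  shows "dynamic_network chg T (\<lambda>j. if j \<le> k then G else G')"
  using assms by (auto simp: dynamic_network_def change_at_single)

text \<open>Two executions leave \<open>G0\<close> in the same round, one for \<open>G1\<close> and
  one for \<open>G2\<close>. As \<open>T\<close> is below \<open>d u\<close>, the node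
  \<open>u\<close> is in the same state in both when its output is due, yet the outputs required
  there differ.\<close>

lemma no_round_algorithm:
  fixes A :: "('s, 'm, 'o) algorithm" and d :: "nat \<Rightarrow> nat"
  assumes G0: "simple_graph G0"
    and G1: "chg G0 G1" "G0 \<noteq> G1" "u \<in> verts G1"
    and G2: "chg G0 G2" "G0 \<noteq> G2" "u \<in> verts G2"
    and nb: "\<And>x. d x > 0 \<Longrightarrow> nbrs G1 x = nbrs G2 x"
    and lip: "\<And>x y. \<lbrakk>d x > 0; y \<in> nbrs G1 x\<rbrakk> \<Longrightarrow> d x \<le> Suc (d y)"
    and T: "T < int (d u)"
    and P: "P G1 u \<noteq> P G2 u"
  shows "\<not> is_round_algorithm chg T P A"
proof
  assume alg: "is_round_algorithm chg T P A"
  \<comment> \<open>For \<open>T \<le> 0\<close> the output is due before the change, so the change is delayed to round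
      \<open>1 - T\<close> and the output of round \<open>0\<close> is considered.\<close>
  define k t where "k = nat (- T)" and "t = nat T"
  define Gs where "Gs G = (\<lambda>j. if j \<le> k then G0 else G)" for G
  have due: "int t = int (Suc k) + T - 1"
    by (simp add: k_def t_def)
  have out: "alg_output A (run A (Gs G) t u) = P G u"
    if "chg G0 G" "G0 \<noteq> G" "u \<in> verts G" for G
  proof -
    have "dynamic_network chg T (Gs G)"
      unfolding Gs_def using G0 that by (intro dynamic_network_single)
    moreover have "change_at (Gs G) (Suc k)"
      unfolding Gs_def using that by (simp add: change_at_single)
    moreover have "Gs G (Suc k) = G"
      by (simp add: Gs_def)
    ultimately show ?thesis
      using alg due that(3) unfolding is_round_algorithm_def by metis
  qed
  have "run A (Gs G1) t u = run A (Gs G2) t u"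
  proof (rule run_indistinguishable[where d = d and k = k])
    \<comment> \<open>If \<open>T\<close> is positive, then \<open>k = 0\<close> and
      \<open>t = T\<close>; otherwise \<open>t = 0\<close>.\<close>
    show "t \<le> k \<or> t < d u + k"
      using T by (auto simp: k_def t_def)
  qed (use nb lip in \<open>auto simp: Gs_def\<close>)
  then show False
    using out[OF G1] out[OF G2] P by simp
qed

section \<open>The pair of graphs to be told apart\<close>

text \<open>Transfers the lower bound from detection to listing: different answers to detection
  force different lists.\<close>

lemma mem_list_nonempty: "mem_list H G v \<noteq> {} \<longleftrightarrow> mem_detect H G v"
  by (auto simp: mem_list_def mem_detect_def)

text \<open>The edge \<open>{a, b}\<close> is a component of its own, so a connected copy through
  \<open>u\<close> avoids it and has only edges of \<open>E\<close>, which are too few.\<close>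

lemma not_mem_detect_few_edges:
  assumes H: "simple_graph H" "connected_graph H"
    and E: "finite E" "card E < card (edges H)" and u: "u \<notin> {a, b}"
    and ab: "\<And>e. e \<in> E \<Longrightarrow> e \<inter> {a, b} = {}"
  shows "\<not> mem_detect H (Graph V (insert {a, b} E)) u"
proof
  assume "mem_detect H (Graph V (insert {a, b} E)) u"
  then obtain K where K: "simple_graph K" "edges K \<subseteq> insert {a, b} E" "u \<in> verts K"
    and iso: "graph_iso K H"
    by (auto simp: mem_detect_def subgraph_of_def)
  have conn: "connected_graph K"
    using H iso by (rule graph_iso_connected)
  have closed: "y \<in> {a, b}" if "(a, y) \<in> (adj_rel K)\<^sup>*" for y
    using that
  proof (induction rule: rtrancl_induct)
    case (step y z)
    then have "{y, z} \<in> insert {a, b} E"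
      using K by (auto simp: adj_rel_iff)
    then show ?case
      using step.IH ab[of "{y, z}"] by (auto simp: doubleton_eq_iff)
  qed simp
  have "{a, b} \<notin> edges K"
  proof
    assume "{a, b} \<in> edges K"
    then have "a \<in> verts K"
      using K(1) simple_graph_edge_verts by metis
    then have "(a, u) \<in> (adj_rel K)\<^sup>*"
      using conn K(3) by (simp add: connected_graph_def)
    then show False
      using closed u by blast
  qed
  then have "edges K \<subseteq> E"
    using K by auto
  then have "card (edges K) \<le> card E"
    using E(1) by (simp add: card_mono)
  then show False
    using graph_iso_card_edges[OF K(1) H(1) iso] E(2) by simp
qed

text \<open>
  Here \<open>E\<close> is the edge set of the copy of \<open>H\<close>, \<open>c\<close> is the image of the edge \<open>e\<close>, and \<open>d\<close> is the
  distance to \<open>c\<close> within the copy.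
\<close>

lemma hard_instance:
  fixes H :: "'h graph"
  assumes H: "simple_graph H" "connected_graph H" and card: "card (verts H) \<ge> 2"
  obtains V E c and a b u :: nat and d :: "nat \<Rightarrow> nat"
  where "simple_graph (Graph V (insert {a, b} E))" "c \<in> E" "a \<noteq> b" "a \<in> V" "b \<in> V" "u \<in> V"
    "{a, b} \<notin> E"
    "mem_detect H (Graph V E) u"
    "\<not> mem_detect H (Graph V (insert {a, b} (E - {c}))) u"
    "\<forall>x. d x > 0 \<longrightarrow> nbrs (Graph V E) x = nbrs (Graph V (insert {a, b} (E - {c}))) x"
    "\<forall>x. \<forall>y \<in> nbrs (Graph V E) x. d x \<le> Suc (d y)"
    "int (node_edge_diam H) - 1 = int (d u)"
proof -
  define n where "n = card (verts H)"
  \<comment> \<open>The copy of \<open>H\<close> will occupy the nodes below \<open>n\<close>, so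
    these two are fresh.\<close>
  define a b where "a = n" and "b = Suc n"
  have fin: "finite (verts H)"
    using H by (simp add: simple_graph_def)
  then obtain f where f: "bij_betw f (verts H) {0..<n}"
    using ex_bij_betw_finite_nat n_def by blast
  then have inj: "inj_on f (verts H)" and img: "f ` verts H = {0..<n}"
    by (auto simp: bij_betw_def)
  have "verts H \<noteq> {}" "edges H \<noteq> {}"
    using H card connected_graph_edge_exists by (simp_all add: connected_graph_def)
  then obtain w e where w: "w \<in> verts H" and e: "e \<in> edges H"
    and diam: "node_edge_diam H = node_edge_dist H w e"
    using H node_edge_diam_attained by metis
  obtain p q where pq: "e = {p, q}" "p \<noteq> q" "p \<in> verts H" "q \<in> verts H"
    using H e by (elim simple_graph_edgeE)
  \<comment> \<open>This is \<open>node_edge_dist\<close> to \<open>e\<close> without the summand 1,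
    which accounts for the 1 subtracted from the diameter.\<close>
  define m where "m x = (MIN v \<in> e. graph_dist H x v)" for x
  define V where "V = {0..<n + 2}"
  define E where "E = (`) f ` edges H"
  define c where "c = f ` e"
  \<comment> \<open>The default 0 covers \<open>a\<close> and \<open>b\<close>, whose neighbour
    lists also differ.\<close>
  define d where
    "d x = (if x \<in> {0..<n} then m (inv_into (verts H) f x) else 0)" for x
  have df: "d (f x) = m x" if "x \<in> verts H" for x
  proof -
    have "f x \<in> {0..<n}"
      using img that by blast
    then show ?thesis
      using inj that by (simp add: d_def del: atLeastLessThan_iff)
  qed
  have m_eq: "m x = min (graph_dist H x p) (graph_dist H x q)" for x
    by (simp add: m_def pq)
  have m0: "m p = 0" "m q = 0"
    by (simp_all add: m_eq graph_dist_self)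
  have m_step: "m x \<le> Suc (m y)" if "{x, y} \<in> edges H" for x y
  proof -
    have "y \<in> verts H"
      using H that simple_graph_edge_verts by metis
    then show ?thesis
      using graph_dist_step[OF H(2) that] pq by (force simp: m_eq min_def)
  qed
  have E_edge: "g \<subseteq> {0..<n} \<and> card g = 2" if gE: "g \<in> E" for g
  proof -
    obtain g' where g': "g' \<in> edges H" "g = f ` g'"
      using gE by (auto simp: E_def)
    then have sub: "g' \<subseteq> verts H" "card g' = 2"
      using H by (auto simp: simple_graph_def)
    then show ?thesis
      using g' inj img card_image inj_on_subset by (metis image_mono)
  qed
  have finE: "finite E"
    using H by (simp add: E_def simple_graph_finite_edges)
  have c: "c \<in> E"
    using e by (simp add: E_def c_def)
  have abE: "g \<inter> {a, b} = {}" if "g \<in> E" for g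
    using E_edge[OF that] by (auto simp: a_def b_def)
  show ?thesis
  proof (rule that[of V a b E c "f w" d])
    show "simple_graph (Graph V (insert {a, b} E))"
      using E_edge by (fastforce simp: simple_graph_def V_def a_def b_def)
    show "c \<in> E" by (rule c)
    show "a \<noteq> b" "a \<in> V" "b \<in> V"
      by (simp_all add: a_def b_def V_def)
    have fw: "f w \<in> {0..<n}"
      using img w by blast
    then show "f w \<in> V"
      by (simp add: V_def)
    show "{a, b} \<notin> E"
      using abE by blast
    show "mem_detect H (Graph V E) (f w)"
    proof -
      let ?K = "Graph {0..<n} E"
      let ?g = "inv_into (verts H) f"
      have "simple_graph ?K"
        using E_edge by (auto simp: simple_graph_def)
      then have "subgraph_of ?K (Graph V E)"
        by (auto simp: subgraph_of_def V_def)
      moreover have "graph_iso ?K H"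
        unfolding graph_iso_def
      proof (intro exI conjI ballI)
        show "bij_betw ?g (verts ?K) (verts H)"
          using f by (simp add: bij_betw_inv_into)
        fix x y assume "x \<in> verts ?K" "y \<in> verts ?K"
        then obtain x' y' where xy: "x' \<in> verts H" "y' \<in> verts H" "x = f x'" "y = f y'"
          using img by (metis graph.sel(1) imageE)
        \<comment> \<open>Injectivity of \<open>f\<close> on nodes makes taking images injective on
          sets of nodes.\<close>
        have "{x', y'} \<in> edges H" if "f ` {x', y'} \<in> E"
        proof -
          obtain g where g: "g \<in> edges H" "f ` {x', y'} = f ` g"
            using \<open>f ` {x', y'} \<in> E\<close> by (auto simp: E_def)
          moreover have "g \<subseteq> verts H"
            using H g by (auto simp: simple_graph_def)
          ultimately show ?thesis
            using inj xy inj_on_image_eq_iff[of f "verts H" "{x', y'}" g] by simp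
        qed
        then have "f ` {x', y'} \<in> E \<longleftrightarrow> {x', y'} \<in> edges H"
          by (auto simp only: E_def)
        then show "({x, y} \<in> edges ?K) = ({?g x, ?g y} \<in> edges H)"
          using xy inj by simp
      qed
      ultimately show ?thesis
        using fw by (auto simp: mem_detect_def)
    qed
    show "\<not> mem_detect H (Graph V (insert {a, b} (E - {c}))) (f w)"
    proof (rule not_mem_detect_few_edges[OF H])
      have "card (E - {c}) < card E"
        using finE c by (rule card_Diff1_less)
      also have "\<dots> \<le> card (edges H)"
        unfolding E_def using H by (intro card_image_le simple_graph_finite_edges)
      finally show "card (E - {c}) < card (edges H)" .
      show "f w \<notin> {a, b}"
        using fw by (auto simp: a_def b_def)
    qed (use finE abE in auto)
    show "\<forall>x. d x > 0 \<longrightarrow> nbrs (Graph V E) x = nbrs (Graph V (insert {a, b} (E - {c}))) x"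
    proof (intro allI impI)
      \<comment> \<open>Lists differ only at \<open>a\<close>, \<open>b\<close> and the ends of
        \<open>c\<close>, and \<open>d\<close> vanishes at all of them.\<close>
      fix x assume dx: "d x > 0"
      have "x < n"
        using dx by (auto simp: d_def split: if_splits)
      moreover have "x \<notin> c"
        using dx pq m0 df by (auto simp: c_def)
      ultimately show "nbrs (Graph V E) x = nbrs (Graph V (insert {a, b} (E - {c}))) x"
        by (auto simp: nbrs_def a_def b_def doubleton_eq_iff)
    qed
    show "\<forall>x. \<forall>y \<in> nbrs (Graph V E) x. d x \<le> Suc (d y)"
    proof (intro allI ballI)
      fix x y assume nbr: "y \<in> nbrs (Graph V E) x"
      obtain g where g: "g \<in> edges H" "{x, y} = f ` g"
        using nbr by (auto simp: nbrs_def E_def)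
      then obtain r s where rs: "g = {r, s}" "r \<in> verts H" "s \<in> verts H"
        using H by (elim simple_graph_edgeE) auto
      \<comment> \<open>Both bounds, since \<open>x\<close> may be the image of either end.\<close>
      then have "m r \<le> Suc (m s)" "m s \<le> Suc (m r)"
        using g m_step by (auto simp: insert_commute)
      moreover have "x = f r \<and> y = f s \<or> x = f s \<and> y = f r"
        using g rs by (auto simp: doubleton_eq_iff)
      ultimately show "d x \<le> Suc (d y)"
        using df rs by auto
    qed
    show "int (node_edge_diam H) - 1 = int (d (f w))"
      using diam df w by (simp add: node_edge_dist_def m_def)
  qed
qed

section \<open>Insertions and deletions, listing and detection\<close>

theorem theorem2p11:
  fixes H :: "'h graph" and T :: int
  assumes "simple_graph H" and "connected_graph H" and "card (verts H) \<ge> 3"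
    and "T < int (node_edge_diam H) - 1"
  shows "(\<nexists>A :: ('s, 'm, nat graph set) algorithm.
             is_round_algorithm edge_insertion T (mem_list H) A) \<and>
         (\<nexists>A :: ('s, 'm, bool) algorithm.
             is_round_algorithm edge_insertion T (mem_detect H) A) \<and>
         (\<nexists>A :: ('s, 'm, nat graph set) algorithm.
             is_round_algorithm edge_deletion T (mem_list H) A) \<and>
         (\<nexists>A :: ('s, 'm, bool) algorithm.
             is_round_algorithm edge_deletion T (mem_detect H) A)"
proof -
  have card: "card (verts H) \<ge> 2"
    using assms(3) by simp
  obtain V E c a b u d where
    simple: "simple_graph (Graph V (insert {a, b} E))" and c: "c \<in> E"
    and ab: "a \<noteq> b" "a \<in> V" "b \<in> V" and u: "u \<in> V" and abE: "{a, b} \<notin> E"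
    and pos: "mem_detect H (Graph V E) u"
    and neg: "\<not> mem_detect H (Graph V (insert {a, b} (E - {c}))) u"
    and nb: "\<forall>x. d x > 0 \<longrightarrow>
               nbrs (Graph V E) x = nbrs (Graph V (insert {a, b} (E - {c}))) x"
    and lip: "\<forall>x. \<forall>y \<in> nbrs (Graph V E) x. d x \<le> Suc (d y)"
    and diam: "int (node_edge_diam H) - 1 = int (d u)"
    by (rule hard_instance[OF assms(1,2) card]) (rule that)
  let ?pos = "Graph V E" and ?neg = "Graph V (insert {a, b} (E - {c}))"
  have T: "T < int (d u)"
    using assms(4) diam by simp
  have c_ab: "c \<noteq> {a, b}"
    using c abE by auto
  obtain p q where pq: "c = {p, q}" "p \<noteq> q" "p \<in> V" "q \<in> V"
    using simple_graph_edgeE[OF simple, of c] c by auto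
  \<comment> \<open>The output type \<open>'x\<close> is kept general, to serve both lists and
    booleans.\<close>
  have ins: "\<not> is_round_algorithm edge_insertion T P A"
    if "P ?pos u \<noteq> P ?neg u" for P and A :: "('s, 'm, 'x) algorithm"
  proof (rule no_round_algorithm[where d = d and u = u])
    show "simple_graph (Graph V (E - {c}))"
      using simple by (auto simp: simple_graph_def)
    show "edge_insertion (Graph V (E - {c})) ?pos"
      using pq c by (force simp: edge_insertion_def)
    show "edge_insertion (Graph V (E - {c})) ?neg"
      using ab abE by (force simp: edge_insertion_def)
  qed (use c abE u nb lip T that in auto)
  have del: "\<not> is_round_algorithm edge_deletion T P A"
    if "P ?pos u \<noteq> P ?neg u" for P and A :: "('s, 'm, 'x) algorithm"
  proof (rule no_round_algorithm[where d = d and u = u])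
    show "simple_graph (Graph V (insert {a, b} E))"
      by (rule simple)
    show "edge_deletion (Graph V (insert {a, b} E)) ?pos"
      using abE by (force simp: edge_deletion_def)
    \<comment> \<open>As \<open>c\<close> is not \<open>{a, b}\<close>, deleting \<open>c\<close>
      commutes with inserting \<open>{a, b}\<close>.\<close>
    show "edge_deletion (Graph V (insert {a, b} E)) ?neg"
      using c c_ab by (force simp: edge_deletion_def)
    show "Graph V (insert {a, b} E) \<noteq> ?neg"
      using c c_ab by auto
  qed (use abE u nb lip T that in auto)
  have list: "mem_list H ?pos u \<noteq> mem_list H ?neg u"
    using pos neg mem_list_nonempty by metis
  have detect: "mem_detect H ?pos u \<noteq> mem_detect H ?neg u"
    using pos neg by simp
  show ?thesis
    using ins[of "mem_list H", OF list] ins[of "mem_detect H", OF detect]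
      del[of "mem_list H", OF list] del[of "mem_detect H", OF detect]
    by blast
qed

end
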